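(* For $n\in\mathbb{N}$, $n\geqslant 1$, let $\mathfrak{U}_n=\{X\in\mathfrak{U}\colon |X|=n\}$, let $\mathfrak{U}_n/\simeq$ be the quotient of $\mathfrak{U}_n$ by the equivalence relation $\simeq$ of weak similarity, and let $\kappa(\mathfrak{U}_n):=\operatorname{card}(\mathfrak{U}_n/\simeq)$. Then $\kappa(\mathfrak{U}_1)=\kappa(\mathfrak{U}_2)=1$, and for every integer $n\geqslant 3$ $$\kappa(\mathfrak{U}_n)=\sum_{k=2}^{n-1}C_{n-3}^{k-2}\,\kappa(\mathfrak{U}_k)\,\kappa(\mathfrak{U}_{n-k}),\qquad\text{where } C_{n-3}^{k-2}=\frac{(n-3)!}{(k-2)!\,(n-k-1)!}.$$
   Context: An ultrametric on a set $X$ is a function $d\colon X\times X\to[0,\infty)$ such that $d(x,y)=d(y,x)$, $d(x,y)=0\Leftrightarrow x=y$, and $d(x,y)\leqslant\max\{d(x,z),d(z,y)\}$ for all $x,y,z\in X$. For a metric space $(X,d)$, the spectrum is $\operatorname{Sp}(X)=\{d(x,y)\colon x,y\in X\}$. $\mathfrak{U}$ is the class of finite ultrametric spaces $X$ with $|\operatorname{Sp}(X)|=|X|$. For metric spaces $(X,d_X)$ and $(Y,d_Y)$, a bijective mapping $\Phi\colon X\to Y$ is a weak similarity if there is a strictly increasing bijective function $f\colon\operatorname{Sp}(Y)\to\operatorname{Sp}(X)$ such that $d_X(x,y)=f(d_Y(\Phi(x),\Phi(y)))$ for all $x,y\in X$. One writes $X\simeq Y$ if a weak similarity $\Phi\colon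 X\to Y$ exists; $\simeq$ is an equivalence relation. *)

theory Defs
  imports "HOL-Analysis.Analysis" "HOL-Library.Infinite_Typeclass"
begin

text \<open>
  A metric space is an element of the library type \<open>'a metric\<close>: a carrier \<open>mspace X :: 'a set\<close>
  with a distance \<open>mdist X\<close>, which is constrained by the metric axioms only on the carrier.
  Values of \<open>mdist X\<close> outside the carrier play no role in any definition below; in particular
  the identity is a weak similarity between two spaces that differ only there.
\<close>

definition ultrametric_on :: "'a set \<Rightarrow> ('a \<Rightarrow> 'a \<Rightarrow> real) \<Rightarrow> bool" where
  "ultrametric_on X d \<longleftrightarrow>
     (\<forall>x\<in>X. \<forall>y\<in>X. 0 \<le> d x y) \<and>
     (\<forall>x\<in>X. \<forall>y\<in>X. d x y = d y x) \<and>
     (\<forall>x\<in>X. \<forall>y\<in>X. d x y = 0 \<longleftrightarrow> x = y) \<and>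
     (\<forall>x\<in>X. \<forall>y\<in>X. \<forall>z\<in>X. d x y \<le> max (d x z) (d z y))"

definition Sp :: "'a metric \<Rightarrow> real set" where
  "Sp X = {mdist X x y | x y. x \<in> mspace X \<and> y \<in> mspace X}"

definition frakU :: "'a metric set" (\<open>\<UU>\<close>) where
  "\<UU> = {X. finite (mspace X) \<and> ultrametric_on (mspace X) (mdist X) \<and> card (Sp X) = card (mspace X)}"

definition frakU_card :: "nat \<Rightarrow> 'a metric set" (\<open>\<UU>\<^bsub>_\<^esub>\<close>) where
  "\<UU>\<^bsub>n\<^esub> = {X \<in> \<UU>. card (mspace X) = n}"

definition weak_similarity :: "'a metric \<Rightarrow> 'b metric \<Rightarrow> ('a \<Rightarrow> 'b) \<Rightarrow> bool" where
  "weak_similarity X Y \<Phi> \<longleftrightarrow>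
     bij_betw \<Phi> (mspace X) (mspace Y) \<and>
     (\<exists>f. bij_betw f (Sp Y) (Sp X) \<and> strict_mono_on (Sp Y) f \<and>
        (\<forall>x\<in>mspace X. \<forall>y\<in>mspace X. mdist X x y = f (mdist Y (\<Phi> x) (\<Phi> y))))"

definition weakly_similar :: "'a metric \<Rightarrow> 'b metric \<Rightarrow> bool" (infix \<open>\<simeq>\<close> 50) where
  "X \<simeq> Y \<longleftrightarrow> (\<exists>\<Phi>. weak_similarity X Y \<Phi>)"

definition weak_sim_rel :: "'a metric set \<Rightarrow> ('a metric \<times> 'a metric) set" where
  "weak_sim_rel \<A> = {(X, Y). X \<in> \<A> \<and> Y \<in> \<A> \<and> X \<simeq> Y}"

definition kappa :: "'a metric set \<Rightarrow> nat" (\<open>\<kappa>\<close>) where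
  "\<kappa> \<A> = card (\<A> // weak_sim_rel \<A>)"

lemma weakly_similar_refl: "X \<simeq> X"
  unfolding weakly_similar_def weak_similarity_def
  by (rule exI[of _ id], intro conjI exI[of _ id]) (auto simp: strict_mono_on_def)

lemma weakly_similar_sym:
  assumes "X \<simeq> Y" shows "Y \<simeq> X"
proof -
  obtain \<Phi> f where bij: "bij_betw \<Phi> (mspace X) (mspace Y)"
    and f: "bij_betw f (Sp Y) (Sp X)" "strict_mono_on (Sp Y) f"
    and d: "\<And>x y. x \<in> mspace X \<Longrightarrow> y \<in> mspace X \<Longrightarrow> mdist X x y = f (mdist Y (\<Phi> x) (\<Phi> y))"
    using assms unfolding weakly_similar_def weak_similarity_def by blast
  define \<Psi> where "\<Psi> = inv_into (mspace X) \<Phi>"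
  define g where "g = inv_into (Sp Y) f"
  have \<Psi>: "bij_betw \<Psi> (mspace Y) (mspace X)"
    unfolding \<Psi>_def by (rule bij_betw_inv_into[OF bij])
  have g: "bij_betw g (Sp X) (Sp Y)"
    unfolding g_def by (rule bij_betw_inv_into[OF f(1)])
  have fg: "f (g s) = s" if "s \<in> Sp X" for s
    using that f(1) unfolding g_def by (simp add: bij_betw_inv_into_right)
  have gf: "g (f s) = s" if "s \<in> Sp Y" for s
    using that f(1) unfolding g_def by (simp add: bij_betw_inv_into_left)
  have "strict_mono_on (Sp X) g"
  proof (rule strict_mono_onI)
    fix r s assume rs: "r \<in> Sp X" "s \<in> Sp X" "r < s"
    have "g r \<in> Sp Y" "g s \<in> Sp Y" using rs g by (auto dest: bij_betwE)
    then show "g r < g s"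
      using rs f(2) fg by (metis linorder_less_linear order_less_asym strict_mono_onD)
  qed
  moreover have "mdist Y x y = g (mdist X (\<Psi> x) (\<Psi> y))"
    if xy: "x \<in> mspace Y" "y \<in> mspace Y" for x y
  proof -
    have "\<Psi> x \<in> mspace X" "\<Psi> y \<in> mspace X" using xy \<Psi> by (auto dest: bij_betwE)
    then have "mdist X (\<Psi> x) (\<Psi> y) = f (mdist Y x y)"
      using d xy bij unfolding \<Psi>_def by (simp add: bij_betw_inv_into_right)
    moreover have "mdist Y x y \<in> Sp Y" using xy unfolding Sp_def by blast
    ultimately show ?thesis by (simp add: gf)
  qed
  ultimately show ?thesis
    using \<Psi> g unfolding weakly_similar_def weak_similarity_def by blast
qed

lemma weakly_similar_trans:
  assumes "X \<simeq> Y" "Y \<simeq> Z" shows "X \<simeq> Z"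
proof -
  obtain \<Phi> f where 1: "bij_betw \<Phi> (mspace X) (mspace Y)"
    "bij_betw f (Sp Y) (Sp X)" "strict_mono_on (Sp Y) f"
    and d1: "\<And>x y. x \<in> mspace X \<Longrightarrow> y \<in> mspace X \<Longrightarrow> mdist X x y = f (mdist Y (\<Phi> x) (\<Phi> y))"
    using assms(1) unfolding weakly_similar_def weak_similarity_def by blast
  obtain \<Psi> g where 2: "bij_betw \<Psi> (mspace Y) (mspace Z)"
    "bij_betw g (Sp Z) (Sp Y)" "strict_mono_on (Sp Z) g"
    and d2: "\<And>x y. x \<in> mspace Y \<Longrightarrow> y \<in> mspace Y \<Longrightarrow> mdist Y x y = g (mdist Z (\<Psi> x) (\<Psi> y))"
    using assms(2) unfolding weakly_similar_def weak_similarity_def by blast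
  have "strict_mono_on (Sp Z) (f \<circ> g)"
  proof (rule strict_mono_onI)
    fix r s assume rs: "r \<in> Sp Z" "s \<in> Sp Z" "r < s"
    have "g r \<in> Sp Y" "g s \<in> Sp Y" using rs 2(2) by (auto dest: bij_betwE)
    then show "(f \<circ> g) r < (f \<circ> g) s"
      using rs 1(3) 2(3) by (simp add: strict_mono_onD)
  qed
  moreover have "mdist X x y = (f \<circ> g) (mdist Z ((\<Psi> \<circ> \<Phi>) x) ((\<Psi> \<circ> \<Phi>) y))"
    if xy: "x \<in> mspace X" "y \<in> mspace X" for x y
    using xy d1 d2 1(1) by (simp add: bij_betwE)
  ultimately show ?thesis
    using bij_betw_trans[OF 1(1) 2(1)] bij_betw_trans[OF 2(2) 1(2)]
    unfolding weakly_similar_def weak_similarity_def by blast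
qed

lemma equiv_weak_sim_rel: "equiv \<A> (weak_sim_rel \<A>)"
  by (rule equivI)
    (auto simp: weak_sim_rel_def refl_on_def sym_def trans_def
      intro: weakly_similar_refl weakly_similar_sym weakly_similar_trans)

text \<open>
  The class of all finite ultrametric spaces is proper. Up to weak similarity nothing is lost by
  taking the carriers inside one infinite type:
\<close>

lemma weakly_similar_in_infinite_type:
  fixes X :: "'b metric"
  assumes "X \<in> \<UU>\<^bsub>n\<^esub>"
  shows "\<exists>Y :: 'a::infinite metric. Y \<in> \<UU>\<^bsub>n\<^esub> \<and> X \<simeq> Y"
proof -
  have X: "finite (mspace X)" "ultrametric_on (mspace X) (mdist X)"
    "card (Sp X) = card (mspace X)" "card (mspace X) = n"
    using assms by (auto simp: frakU_card_def frakU_def)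
  obtain h :: "'b \<Rightarrow> 'a" where h: "inj_on h (mspace X)"
    using arb_inj_on_finite_infinite[OF X(1)] by blast
  define k where "k = inv_into (mspace X) h"
  have kh: "k (h x) = x" if "x \<in> mspace X" for x
    using that h by (simp add: k_def)
  define M where "M = h ` mspace X"
  define e where "e = (\<lambda>x y. mdist X (k x) (k y))"
  interpret Metric_space M e
    by standard (auto simp: M_def e_def kh mdist_commute mdist_triangle inj_on_eq_iff[OF h])
  define Y where "Y = metric (M, e)"
  have Y [simp]: "mspace Y = M" "mdist Y = e" by (simp_all add: Y_def)
  have Sp: "Sp Y = Sp X"
    unfolding Sp_def by (auto simp: M_def e_def kh; metis imageI kh)
  have "ultrametric_on M e"
    using X(2) h by (auto simp: ultrametric_on_def M_def e_def kh dest: inj_onD)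
  moreover have "card M = n" "finite M"
    using X h by (auto simp: M_def card_image)
  ultimately have "Y \<in> \<UU>\<^bsub>n\<^esub>"
    using X Sp by (simp add: frakU_card_def frakU_def)
  moreover have "weak_similarity X Y h"
    unfolding weak_similarity_def Sp
    by (intro conjI exI[of _ id])
      (use h in \<open>auto simp: M_def e_def kh strict_mono_on_def bij_betw_def\<close>)
  ultimately show ?thesis unfolding weakly_similar_def by blast
qed

end

theory Submission
  imports Defs "HOL-Library.Tree"
begin

text \<open>
  Let \<open>D\<close> be the diameter of a finite ultrametric space \<open>X\<close> with at least two points. An open ball
  of radius \<open>D\<close> and its complement are at constant distance \<open>D\<close>, so an induction gives
  \<open>card (Sp X) \<le> card X\<close>; if equality holds, then it holds for both parts, their spectra meet only
  in \<open>0\<close>, and \<open>D\<close> occurs in neither. Hence a space in \<open>\<UU>\<close> is determined up to isometry by a binary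
  tree whose inner nodes carry the nonzero distances, each once and decreasing along branches, and
  up to weak similarity only the order of the labels matters. To remove the symmetry between the
  two subtrees, the one containing the largest label below the root is put on the left. The left
  subtree of a tree with at least two inner nodes then contains the second largest label, and
  choosing which of the other \<open>n - 3\<close> labels accompany it yields the recurrence.
\<close>

section \<open>Ranks in a finite linear order\<close>

definition rank_in :: "'a::linorder set \<Rightarrow> 'a \<Rightarrow> nat" where
  "rank_in S s = card {r \<in> S. r < s}"

lemma rank_in_strict_mono: "finite S \<Longrightarrow> strict_mono_on S (rank_in S)"
  unfolding rank_in_def by (rule strict_mono_onI, rule psubset_card_mono) auto

lemma rank_in_less_iff:
  assumes "finite S" "r \<in> S" "s \<in> S"
  shows "rank_in S r < rank_in S s \<longleftrightarrow> r < s"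
  using strict_mono_on_less[OF rank_in_strict_mono[OF assms(1)]] assms by blast

lemma rank_in_bij:
  assumes "finite S"
  shows "bij_betw (rank_in S) S {..<card S}"
proof -
  have inj: "inj_on (rank_in S) S"
    using assms by (intro strict_mono_on_imp_inj_on rank_in_strict_mono)
  have "rank_in S ` S \<subseteq> {..<card S}"
    using assms by (auto simp: rank_in_def intro!: psubset_card_mono)
  then have "rank_in S ` S = {..<card S}"
    by (rule card_subset_eq[rotated]) (simp_all add: card_image inj)
  then show ?thesis using inj by (simp add: bij_betw_def)
qed

text \<open>A strictly increasing map carries the elements below \<open>s\<close> bijectively to the
  elements of the image below \<open>f s\<close>. This is why ranks of distances survive a weak
  similarity.\<close>

lemma rank_in_image:
  assumes "strict_mono_on S f" "s \<in> S"
  shows "rank_in (f ` S) (f s) = rank_in S s"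
proof -
  have "{r \<in> f ` S. r < f s} = f ` {r \<in> S. r < s}"
    using assms strict_mono_on_less[OF assms(1)] by auto
  moreover have "inj_on f {r \<in> S. r < s}"
    using strict_mono_on_imp_inj_on[OF assms(1)] by (rule inj_on_subset) auto
  ultimately show ?thesis by (simp add: rank_in_def card_image)
qed

section \<open>Canonical labelled trees and the distances they describe\<close>

text \<open>The last conjunct fixes the order of the subtrees. Written with a quantifier instead of
  \<open>Max\<close>, it also covers empty label sets: a leaf on the left forces a leaf on the
  right.\<close>

fun canon :: "nat tree \<Rightarrow> bool" where
  "canon Leaf \<longleftrightarrow> True"
| "canon (Node l v r) \<longleftrightarrow> canon l \<and> canon r \<and> set_tree l \<inter> set_tree r = {} \<and>
     (\<forall>x\<in>set_tree l \<union> set_tree r. x < v) \<and> (\<forall>y\<in>set_tree r. \<exists>x\<in>set_tree l. y < x)"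

definition canon_trees :: "nat set \<Rightarrow> nat tree set" where
  "canon_trees S = {t. canon t \<and> set_tree t = S}"

text \<open>Leaves stand for points but do not name them, so a tree determines \<open>d\<close> on
  \<open>M\<close> only up to isometry: the distance of two distinct points is the label of their
  lowest common ancestor.\<close>

fun represents :: "nat tree \<Rightarrow> 'a set \<Rightarrow> ('a \<Rightarrow> 'a \<Rightarrow> nat) \<Rightarrow> bool" where
  "represents Leaf M d \<longleftrightarrow> (\<exists>x. M = {x} \<and> d x x = 0)"
| "represents (Node l v r) M d \<longleftrightarrow> (\<exists>A B. M = A \<union> B \<and> A \<inter> B = {} \<and>
     represents l A d \<and> represents r B d \<and> (\<forall>a\<in>A. \<forall>b\<in>B. d a b = v \<and> d b a = v))"

section \<open>Counting canonical trees\<close>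

lemma canon_card_set_tree: "canon t \<Longrightarrow> card (set_tree t) = size t"
proof (induction t)
  case (Node l v r)
  then have "v \<notin> set_tree l \<union> set_tree r" by auto
  then show ?case using Node by (simp add: card_Un_disjoint)
qed simp

text \<open>The root label occurs in neither subtree, so both subtrees have proper subsets of
  \<open>S\<close> as label sets, and the induction runs over those.\<close>

lemma finite_canon_trees: "finite S \<Longrightarrow> finite (canon_trees S)"
proof (induction S rule: finite_psubset_induct)
  case (psubset S)
  let ?L = "\<Union>A\<in>{A. A \<subset> S}. canon_trees A"
  have "finite {A. A \<subset> S}"
    by (rule finite_subset[of _ "Pow S"]) (use psubset.hyps in auto)
  then have "finite ?L" using psubset by (intro finite_UN_I) auto
  moreover have "canon_trees S \<subseteq> insert Leaf ((\<lambda>(l, v, r). Node l v r) ` (?L \<times> S \<times> ?L))"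
  proof
    fix t assume t: "t \<in> canon_trees S"
    show "t \<in> insert Leaf ((\<lambda>(l, v, r). Node l v r) ` (?L \<times> S \<times> ?L))"
    proof (cases t)
      case (Node l v r)
      have "v \<notin> set_tree l" "v \<notin> set_tree r" using t Node by (auto simp: canon_trees_def)
      then have "set_tree l \<subset> S" "set_tree r \<subset> S" using t Node by (auto simp: canon_trees_def)
      then have "(l, v, r) \<in> ?L \<times> S \<times> ?L" using t Node by (auto simp: canon_trees_def)
      moreover have "t = (\<lambda>(l, v, r). Node l v r) (l, v, r)" using Node by simp
      ultimately show ?thesis by (intro insertI2 image_eqI)
    qed simp
  qed
  ultimately show ?case using psubset.hyps by (meson finite_SigmaI finite_imageI finite_insert finite_subset)
qed

lemma canon_map_tree:
  assumes "canon t" "strict_mono_on (set_tree t) f"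
  shows "canon (map_tree f t)"
  using assms
proof (induction t)
  case (Node l v r)
  have mono: "f x < f y" if "x \<in> set_tree (Node l v r)" "y \<in> set_tree (Node l v r)" "x < y" for x y
    using Node.prems(2) that by (rule strict_mono_onD)
  have inj: "inj_on f (set_tree (Node l v r))"
    using Node.prems(2) by (rule strict_mono_on_imp_inj_on)
  have "canon (map_tree f l)" "canon (map_tree f r)"
    using Node.prems by (auto intro!: Node.IH intro: monotone_on_subset)
  moreover have "f ` set_tree l \<inter> f ` set_tree r = {}"
    using Node.prems(1) inj_on_image_Int[OF inj, of "set_tree l" "set_tree r"] by auto
  moreover have "\<forall>x\<in>f ` set_tree l \<union> f ` set_tree r. x < f v"
    using Node.prems(1) mono by auto
  moreover have "\<exists>x\<in>f ` set_tree l. f y < x" if y: "y \<in> set_tree r" for y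
  proof -
    obtain x where "x \<in> set_tree l" "y < x" using Node.prems(1) y by auto
    then show ?thesis using mono[of y x] y by auto
  qed
  ultimately show ?case by (simp add: tree.set_map)
qed simp

lemma card_canon_trees_image:
  assumes "finite S" "strict_mono_on S f"
  shows "card (canon_trees S) \<le> card (canon_trees (f ` S))"
proof (rule card_inj_on_le[where f = "map_tree f"])
  have inj: "inj_on f S" using assms(2) by (rule strict_mono_on_imp_inj_on)
  show "inj_on (map_tree f) (canon_trees S)"
    by (rule inj_onI, rule tree.inj_map_strong)
      (auto simp: canon_trees_def dest: inj_onD[OF inj])
  show "map_tree f ` canon_trees S \<subseteq> canon_trees (f ` S)"
    using assms(2) by (auto simp: canon_trees_def tree.set_map intro!: canon_map_tree)
  show "finite (canon_trees (f ` S))" using assms(1) by (simp add: finite_canon_trees)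
qed

text \<open>The index counts inner nodes, one fewer than the points represented; this is the shift
  by one in \<open>kappa_frakU_card\<close>.\<close>

definition canon_count :: "nat \<Rightarrow> nat" where
  "canon_count m = card (canon_trees {..<m})"

text \<open>Only the order of the labels matters: relabelling by ranks and by the inverse of the
  rank map, both strictly increasing, gives the two inequalities.\<close>

lemma card_canon_trees:
  assumes "finite S"
  shows "card (canon_trees S) = canon_count (card S)"
proof (rule antisym)
  let ?r = "rank_in S" and ?n = "card S"
  have r: "bij_betw ?r S {..<?n}" using assms by (rule rank_in_bij)
  then show "card (canon_trees S) \<le> canon_count ?n"
    using card_canon_trees_image[OF assms rank_in_strict_mono[OF assms]]
    by (simp add: bij_betw_def canon_count_def)
  let ?g = "inv_into S ?r"
  have g: "bij_betw ?g {..<?n} S" using r by (rule bij_betw_inv_into)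
  have "strict_mono_on {..<?n} ?g"
  proof (rule strict_mono_onI)
    fix i j assume "i \<in> {..<?n}" "j \<in> {..<?n}" "i < j"
    then show "?g i < ?g j"
      using rank_in_less_iff[OF assms, of "?g i" "?g j"] bij_betwE[OF g]
        bij_betw_inv_into_right[OF r] by simp
  qed
  then show "canon_count ?n \<le> card (canon_trees S)"
    using card_canon_trees_image[of "{..<?n}" ?g] g by (simp add: bij_betw_def canon_count_def)
qed

lemma canon_trees_empty: "canon_trees {} = {Leaf}"
  by (auto simp: canon_trees_def)

lemma canon_count_0: "canon_count 0 = 1"
  by (simp add: canon_count_def canon_trees_empty)

lemma canon_count_1: "canon_count 1 = 1"
proof -
  have "t = Node Leaf 0 Leaf" if "canon t" "set_tree t = {0}" for t
    using that
  proof (cases t)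
    case (Node l v r)
    then have "set_tree l = {}" "set_tree r = {}" "v = 0" using that by fastforce+
    then show ?thesis using Node by simp
  qed simp
  then have "canon_trees {..<1} = {Node Leaf 0 Leaf}"
    by (auto simp: canon_trees_def lessThan_Suc)
  then show ?thesis by (simp add: canon_count_def)
qed

text \<open>The largest label \<open>v\<close> must be the root and the second largest
  \<open>w\<close> must lie on the left. Conversely, \<open>w\<close> on the left dominates every
  label on the right, so any set \<open>A\<close> of companions of \<open>w\<close> and any two
  canonical subtrees are admissible.\<close>

lemma canon_trees_insert2:
  assumes "w < v" "\<forall>x\<in>S. x < w"
  shows "canon_trees (insert v (insert w S)) =
    (\<Union>A\<in>Pow S. (\<lambda>(l, r). Node l v r) ` (canon_trees (insert w A) \<times> canon_trees (S - A)))"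
    (is "?L = ?R")
proof
  show "?L \<subseteq> ?R"
  proof
    fix t assume t: "t \<in> ?L"
    then obtain l u r where t_eq: "t = Node l u r" by (cases t) (auto simp: canon_trees_def)
    have c: "canon l" "canon r" "set_tree l \<inter> set_tree r = {}"
      "\<forall>x\<in>set_tree l \<union> set_tree r. x < u" "\<forall>y\<in>set_tree r. \<exists>x\<in>set_tree l. y < x"
      and s: "insert u (set_tree l \<union> set_tree r) = insert v (insert w S)"
      using t by (auto simp: canon_trees_def t_eq)
    have "u = v"
    proof (rule ccontr)
      assume "u \<noteq> v"
      moreover have "v \<in> insert u (set_tree l \<union> set_tree r)" by (simp add: s)
      ultimately have "v < u" using c(4) by auto
      moreover have "u \<in> insert v (insert w S)" by (simp flip: s)
      ultimately show False using assms by auto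
    qed
    have v: "v \<notin> S" "v \<noteq> w" "w \<notin> S" using assms by auto
    have lr: "set_tree l \<union> set_tree r = insert w S"
      using c(4) s v unfolding \<open>u = v\<close> by (subst (asm) insert_ident) auto
    \<comment> \<open>On the right, \<open>w\<close> would need a larger label on the left, but only
      \<open>v\<close> exceeds \<open>w\<close>.\<close>
    have w: "w \<in> set_tree l"
    proof (rule ccontr)
      assume "w \<notin> set_tree l"
      then obtain x where "x \<in> set_tree l" "w < x" using c(5) lr by blast
      then show False using lr assms by (metis UnCI insertE less_asym less_irrefl)
    qed
    define A where "A = set_tree l - {w}"
    have A: "A \<in> Pow S" "insert w A = set_tree l" "S - A = set_tree r"
      using lr w c(3) v by (auto simp: A_def)
    then have "(l, r) \<in> canon_trees (insert w A) \<times> canon_trees (S - A)"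
      using c by (simp add: canon_trees_def)
    then have "t \<in> (\<lambda>(l, r). Node l v r) ` (canon_trees (insert w A) \<times> canon_trees (S - A))"
      by (rule rev_image_eqI) (simp add: t_eq \<open>u = v\<close>)
    with A(1) show "t \<in> ?R" by (rule UN_I)
  qed
  show "?R \<subseteq> ?L"
  proof
    fix t assume "t \<in> ?R"
    then obtain A l r where *: "A \<subseteq> S" "t = Node l v r" "l \<in> canon_trees (insert w A)"
      "r \<in> canon_trees (S - A)" by auto
    have "w \<notin> S" using assms by auto
    moreover have "\<forall>x\<in>S. x < v" using assms by force
    ultimately show "t \<in> ?L" using * assms by (auto simp: canon_trees_def)
  qed
qed

lemma sum_Pow_card:
  fixes g :: "nat \<Rightarrow> 'b::comm_semiring_1"
  assumes "finite S"
  shows "(\<Sum>A\<in>Pow S. g (card A)) = (\<Sum>j\<le>card S. of_nat (card S choose j) * g j)"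
proof -
  have "(\<Sum>A\<in>Pow S. g (card A)) = (\<Sum>j\<le>card S. \<Sum>A\<in>{A \<in> Pow S. card A = j}. g (card A))"
    by (rule sum.group[symmetric]) (use assms in \<open>auto intro: card_mono\<close>)
  also have "\<dots> = (\<Sum>j\<le>card S. of_nat (card S choose j) * g j)"
    using n_subsets[OF assms] by (intro sum.cong) auto
  finally show ?thesis .
qed

text \<open>Of the labels up to \<open>m + 1\<close>, the root takes \<open>m + 1\<close>, the left
  subtree takes \<open>m\<close>, and \<open>j\<close> of the remaining \<open>m\<close> labels join
  it.\<close>

lemma canon_count_rec:
  "canon_count (m + 2) = (\<Sum>j\<le>m. (m choose j) * (canon_count (j + 1) * canon_count (m - j)))"
proof -
  define S where "S = {..<m}"
  let ?F = "\<lambda>A. (\<lambda>(l, r). Node l (Suc m) r) ` (canon_trees (insert m A) \<times> canon_trees (S - A))"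
  have S: "finite S" "card S = m" "m \<notin> S" by (auto simp: S_def)
  have eq: "{..<m + 2} = insert (Suc m) (insert m S)" by (auto simp: S_def)
  have "canon_count (m + 2) = card (\<Union>A\<in>Pow S. ?F A)"
    unfolding canon_count_def eq by (subst canon_trees_insert2) (auto simp: S_def)
  also have "\<dots> = (\<Sum>A\<in>Pow S. card (?F A))"
  proof (rule card_UN_disjoint)
    show "\<forall>A\<in>Pow S. finite (?F A)"
      using S by (auto intro!: finite_imageI finite_canon_trees intro: finite_subset)
    \<comment> \<open>The left subtree has label set \<open>insert m A\<close>, and \<open>m\<close>
      is not in \<open>S\<close>, so a tree determines \<open>A\<close>.\<close>
    show "\<forall>A\<in>Pow S. \<forall>B\<in>Pow S. A \<noteq> B \<longrightarrow> ?F A \<inter> ?F B = {}"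
      using S(3) by (auto simp: canon_trees_def)
  qed (use S in simp)
  also have "\<dots> = (\<Sum>A\<in>Pow S. canon_count (card A + 1) * canon_count (m - card A))"
  proof (rule sum.cong)
    fix A assume "A \<in> Pow S"
    then have A: "A \<subseteq> S" "finite A" "m \<notin> A" using S finite_subset by auto
    have "card (?F A) = card (canon_trees (insert m A) \<times> canon_trees (S - A))"
      by (rule card_image) (auto simp: inj_on_def)
    also have "\<dots> = canon_count (card A + 1) * canon_count (m - card A)"
      using A S by (simp add: card_cartesian_product card_canon_trees card_Diff_subset)
    finally show "card (?F A) = canon_count (card A + 1) * canon_count (m - card A)" .
  qed simp
  also have "\<dots> = (\<Sum>j\<le>m. (m choose j) * (canon_count (j + 1) * canon_count (m - j)))"
    using sum_Pow_card[OF S(1), of "\<lambda>j. canon_count (j + 1) * canon_count (m - j)"] S(2) by simp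
  finally show ?thesis .
qed

section \<open>Value sets, cardinalities and isometries of represented distances\<close>

lemma image_Times_Un_const:
  assumes "A \<noteq> {}" "B \<noteq> {}" "\<forall>a\<in>A. \<forall>b\<in>B. f a b = c \<and> f b a = c"
  shows "(\<lambda>(x, y). f x y) ` ((A \<union> B) \<times> (A \<union> B)) =
    insert c ((\<lambda>(x, y). f x y) ` (A \<times> A) \<union> (\<lambda>(x, y). f x y) ` (B \<times> B))"
proof -
  have const: "(\<lambda>(x, y). f x y) ` (C \<times> D) = {c}"
    if "C \<noteq> {}" "D \<noteq> {}" "\<And>a b. a \<in> C \<Longrightarrow> b \<in> D \<Longrightarrow> f a b = c" for C D
  proof -
    have "(\<lambda>(x, y). f x y) ` (C \<times> D) = (\<lambda>_. c) ` (C \<times> D)"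
      using that(3) by (intro image_cong) auto
    then show ?thesis using that(1,2) by (simp add: image_constant_conv)
  qed
  have "(A \<union> B) \<times> (A \<union> B) = A \<times> A \<union> B \<times> B \<union> A \<times> B \<union> B \<times> A" by auto
  moreover have "(\<lambda>(x, y). f x y) ` (A \<times> B) = {c}" using assms by (intro const) auto
  moreover have "(\<lambda>(x, y). f x y) ` (B \<times> A) = {c}" using assms by (intro const) auto
  ultimately show ?thesis by (simp add: image_Un)
qed

lemma represents_values:
  "represents t M d \<Longrightarrow> (\<lambda>(x, y). d x y) ` (M \<times> M) = insert 0 (set_tree t)"
proof (induction t arbitrary: M)
  case (Node l v r)
  then obtain A B where AB: "M = A \<union> B" "represents l A d" "represents r B d"
    "\<forall>a\<in>A. \<forall>b\<in>B. d a b = v \<and> d b a = v" by auto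
  note IH = Node.IH(1)[OF AB(2)] Node.IH(2)[OF AB(3)]
  \<comment> \<open>Both value sets contain 0, so both parts are inhabited and the root label
    \<open>v\<close> is attained.\<close>
  have "A \<noteq> {}" "B \<noteq> {}" using IH by auto
  then have "(\<lambda>(x, y). d x y) ` ((A \<union> B) \<times> (A \<union> B)) =
      insert v (insert 0 (set_tree l) \<union> insert 0 (set_tree r))"
    using image_Times_Un_const[OF _ _ AB(4)] IH by simp
  then show ?case by (simp add: AB(1) insert_commute)
qed auto

lemma represents_nonempty: "represents t M d \<Longrightarrow> M \<noteq> {}"
  using represents_values by fastforce

lemma represents_value:
  "represents t M d \<Longrightarrow> x \<in> M \<Longrightarrow> y \<in> M \<Longrightarrow> d x y \<in> insert 0 (set_tree t)"
  using represents_values by fastforce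

lemma represents_card: "represents t M d \<Longrightarrow> finite M \<and> card M = size t + 1"
proof (induction t arbitrary: M)
  case (Node l v r)
  then obtain A B where "M = A \<union> B" "A \<inter> B = {}" "represents l A d" "represents r B d" by auto
  then show ?case using Node.IH by (fastforce simp: card_Un_disjoint)
qed auto

text \<open>Trees are transported along isometries. The case of the identity shows that only the
  values of the distance on \<open>M\<close> count.\<close>

lemma represents_image:
  assumes "represents t M d" "inj_on \<Phi> M"
    and "\<And>x y. x \<in> M \<Longrightarrow> y \<in> M \<Longrightarrow> e (\<Phi> x) (\<Phi> y) = d x y"
  shows "represents t (\<Phi> ` M) e"
  using assms
proof (induction t arbitrary: M)
  case (Node l v r)
  then obtain A B where AB: "M = A \<union> B" "A \<inter> B = {}" "represents l A d" "represents r B d"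
    "\<forall>a\<in>A. \<forall>b\<in>B. d a b = v \<and> d b a = v" by auto
  have "represents l (\<Phi> ` A) e" "represents r (\<Phi> ` B) e"
    using Node.prems AB by (auto intro!: Node.IH simp: inj_on_Un)
  moreover have "\<Phi> ` A \<inter> \<Phi> ` B = {}"
    using inj_on_image_Int[OF Node.prems(2), of A B] AB by auto
  moreover have "\<forall>a\<in>\<Phi> ` A. \<forall>b\<in>\<Phi> ` B. e a b = v \<and> e b a = v"
    using Node.prems(3) AB by simp
  ultimately show ?case unfolding represents.simps AB(1) image_Un
    by (intro exI[of _ "\<Phi> ` A"] exI[of _ "\<Phi> ` B"]) simp
qed auto

lemma represents_cong:
  assumes "represents t M d" "\<And>x y. x \<in> M \<Longrightarrow> y \<in> M \<Longrightarrow> e x y = d x y"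
  shows "represents t M e"
  using represents_image[OF assms(1), of id e] assms(2) by simp

text \<open>Isometries between corresponding parts glue together, since every cross distance equals
  the root label on both sides.\<close>

lemma represents_isometry:
  assumes "represents t M d" "represents t N e"
  shows "\<exists>\<Phi>. bij_betw \<Phi> M N \<and> (\<forall>x\<in>M. \<forall>y\<in>M. e (\<Phi> x) (\<Phi> y) = d x y)"
  using assms
proof (induction t arbitrary: M N)
  case Leaf
  then obtain x y where "M = {x}" "N = {y}" "d x x = 0" "e y y = 0" by auto
  then show ?case by (intro exI[of _ "\<lambda>_. y"]) auto
next
  case (Node l v r)
  obtain A B where AB: "M = A \<union> B" "A \<inter> B = {}" "represents l A d" "represents r B d"
    "\<forall>a\<in>A. \<forall>b\<in>B. d a b = v \<and> d b a = v" using Node.prems by auto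
  obtain C D where CD: "N = C \<union> D" "C \<inter> D = {}" "represents l C e" "represents r D e"
    "\<forall>a\<in>C. \<forall>b\<in>D. e a b = v \<and> e b a = v" using Node.prems by auto
  obtain f where f: "bij_betw f A C" "\<forall>x\<in>A. \<forall>y\<in>A. e (f x) (f y) = d x y"
    using Node.IH(1)[OF AB(3) CD(3)] by blast
  obtain g where g: "bij_betw g B D" "\<forall>x\<in>B. \<forall>y\<in>B. e (g x) (g y) = d x y"
    using Node.IH(2)[OF AB(4) CD(4)] by blast
  define h where "h = (\<lambda>x. if x \<in> A then f x else g x)"
  have hA: "h x = f x" if "x \<in> A" for x using that by (simp add: h_def)
  have hB: "h x = g x" if "x \<in> B" for x using that AB(2) by (auto simp: h_def)
  have "bij_betw h A C" "bij_betw h B D"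
    using f(1) g(1) hA hB bij_betw_cong[of A h f C] bij_betw_cong[of B h g D] by auto
  then have "bij_betw h M N" unfolding AB(1) CD(1) using CD(2) by (rule bij_betw_combine)
  moreover have "e (h x) (h y) = d x y" if "x \<in> M" "y \<in> M" for x y
    using that AB(1,5) CD(5) f g bij_betwE[OF f(1)] bij_betwE[OF g(1)] by (auto simp: hA hB)
  ultimately show ?case by blast
qed

section \<open>Uniqueness of the canonical tree of a distance\<close>

text \<open>The maximum of \<open>P\<close> would lie below an element of \<open>Q\<close>, which in
  turn lies below an element of \<open>P\<close>. Applied in both directions, this leaves only
  unlabelled subtrees when two subtrees could be exchanged.\<close>

lemma dominated_antisym:
  fixes P Q :: "'a::linorder set"
  assumes "finite P" "finite Q" "\<forall>y\<in>Q. \<exists>x\<in>P. y < x" "\<forall>y\<in>P. \<exists>x\<in>Q. y < x"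
  shows "P = {}"
proof (rule ccontr)
  assume "P \<noteq> {}"
  then obtain y x where "y \<in> Q" "Max P < y" "x \<in> P" "y < x"
    using assms by (meson Max_in)
  moreover from this have "x \<le> Max P" using assms(1) by simp
  ultimately show False by order
qed

text \<open>Comparing the maxima decides which of two subtrees can be put on the left.\<close>

lemma dominated_total:
  fixes P Q :: "'a::linorder set"
  assumes "finite P" "finite Q" "P \<inter> Q = {}"
  shows "(\<forall>y\<in>Q. \<exists>x\<in>P. y < x) \<or> (\<forall>y\<in>P. \<exists>x\<in>Q. y < x)"
proof (cases "P = {} \<or> Q = {}")
  case False
  then have "Max P \<in> P" "Max Q \<in> Q" using assms by auto
  then have "Max P < Max Q \<or> Max Q < Max P" using assms(3) by (metis disjoint_iff linorder_neqE)
  then show ?thesis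
    using assms \<open>Max P \<in> P\<close> \<open>Max Q \<in> Q\<close> by (meson Max_ge order.strict_trans1)
qed auto

text \<open>Recovers the two parts of \<open>M\<close> from the distance alone, up to exchanging them.\<close>

lemma represents_ball:
  assumes "represents t A d" "\<forall>x\<in>insert 0 (set_tree t). x < v" "a \<in> A"
    and "M = A \<union> B" "\<forall>b\<in>B. d a b = v"
  shows "A = {y \<in> M. d a y < v}"
proof -
  have "d a y < v" if "y \<in> A" for y
    using assms(2) represents_value[OF assms(1,3) that] by (rule bspec)
  then show ?thesis using assms(4,5) by auto
qed

text \<open>The root label is the largest distance, and the two parts are the open balls of that
  radius, so both trees split \<open>M\<close> into the same two sets. If the sets come in opposite
  order, canonicity forces both subtrees to be leaves.\<close>

lemma represents_unique:
  assumes "represents t M d" "represents t' M d" "canon t" "canon t'"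
    "0 \<notin> set_tree t" "0 \<notin> set_tree t'"
  shows "t = t'"
  using assms
proof (induction t arbitrary: M t')
  case Leaf
  then show ?case using represents_card[OF Leaf(1)] represents_card[OF Leaf(2)] by simp
next
  case (Node l v r)
  obtain A B where AB: "M = A \<union> B" "A \<inter> B = {}" "represents l A d" "represents r B d"
    "\<forall>a\<in>A. \<forall>b\<in>B. d a b = v \<and> d b a = v" using Node.prems by auto
  have "size t' \<noteq> 0"
    using represents_card[OF Node.prems(1)] represents_card[OF Node.prems(2)] by simp
  then obtain l' v' r' where t': "t' = Node l' v' r'" by (cases t') auto
  obtain A' B' where AB': "M = A' \<union> B'" "A' \<inter> B' = {}" "represents l' A' d" "represents r' B' d"
    "\<forall>a\<in>A'. \<forall>b\<in>B'. d a b = v' \<and> d b a = v'" using Node.prems t' by auto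
  have sets: "insert v (set_tree l \<union> set_tree r) = insert v' (set_tree l' \<union> set_tree r')"
    using represents_values[OF Node.prems(1)] represents_values[OF Node.prems(2)] Node.prems(5,6)
    unfolding t' by (simp add: insert_ident)
  have lt: "\<forall>x\<in>set_tree l \<union> set_tree r. x < v" "\<forall>x\<in>set_tree l' \<union> set_tree r'. x < v'"
    using Node.prems(3,4) t' by auto
  have v': "v' = v"
    using sets lt by (metis insertE insertI1 less_asym)
  \<comment> \<open>Positivity is needed because distances inside a part may be 0, and these must
    also lie below the radius \<open>v\<close>.\<close>
  have "0 < v" using Node.prems(5) by (auto intro: gr0I)
  have lt': "\<forall>x\<in>insert 0 (set_tree l). x < v" "\<forall>x\<in>insert 0 (set_tree l'). x < v"
    "\<forall>x\<in>insert 0 (set_tree r'). x < v"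
    using lt \<open>0 < v\<close> v' by simp_all
  have A: "A = {y \<in> M. d a y < v}" if "a \<in> A" for a
    using AB(3) lt'(1) that AB(1) by (rule represents_ball) (use AB(5) that in simp)
  have A': "A' = {y \<in> M. d a y < v}" if "a \<in> A'" for a
    using AB'(3) lt'(2) that AB'(1) by (rule represents_ball) (use AB'(5) v' that in simp)
  have B': "B' = {y \<in> M. d a y < v}" if "a \<in> B'" for a
    using AB'(4) lt'(3) that AB'(1)[unfolded Un_commute[of A']]
    by (rule represents_ball) (use AB'(5) v' that in simp)
  obtain a where a: "a \<in> A" using represents_nonempty[OF AB(3)] by blast
  have c: "canon l" "canon r" "canon l'" "canon r'" "0 \<notin> set_tree l" "0 \<notin> set_tree r"
    "0 \<notin> set_tree l'" "0 \<notin> set_tree r'"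
    "\<forall>y\<in>set_tree r. \<exists>x\<in>set_tree l. y < x" "\<forall>y\<in>set_tree r'. \<exists>x\<in>set_tree l'. y < x"
    using Node.prems(3-6) t' by auto
  \<comment> \<open>The part of the second tree that contains \<open>a\<close> is the same ball as
    \<open>A\<close>.\<close>
  have "a \<in> A' \<or> a \<in> B'" using a AB(1) AB'(1) by blast
  then show ?case
  proof
    assume "a \<in> A'"
    then have "A = A'" using A[OF a] A' by simp
    moreover from this have "B = B'" using AB(1,2) AB'(1,2) by blast
    ultimately have "l = l'" "r = r'" using Node.IH AB AB' c by blast+
    then show ?thesis using t' v' by simp
  next
    assume "a \<in> B'"
    then have "A = B'" using A[OF a] B' by simp
    moreover from this have "B = A'" using AB(1,2) AB'(1,2) by blast
    ultimately have "l = r'" "r = l'" using Node.IH AB AB' c by blast+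
    \<comment> \<open>With the parts exchanged, each label set dominates the other.\<close>
    moreover have "set_tree l = {}" "set_tree r = {}"
      using dominated_antisym[of "set_tree l" "set_tree r"]
        dominated_antisym[of "set_tree r" "set_tree l"] c(9,10) calculation by auto
    ultimately show ?thesis using t' v' by simp
  qed
qed

section \<open>From trees to ultrametrics\<close>

text \<open>Ranks and labels are natural numbers while \<open>ultrametric_on\<close> expects real
  distances; this moves the axioms to \<open>nat\<close>.\<close>

lemma ultrametric_on_of_nat_iff:
  "ultrametric_on M (\<lambda>x y. real (d x y)) \<longleftrightarrow>
     (\<forall>x\<in>M. \<forall>y\<in>M. d x y = d y x) \<and> (\<forall>x\<in>M. \<forall>y\<in>M. d x y = 0 \<longleftrightarrow> x = y) \<and>
     (\<forall>x\<in>M. \<forall>y\<in>M. \<forall>z\<in>M. d x y \<le> max (d x z) (d z y))"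
  unfolding ultrametric_on_def
  by (simp only: of_nat_0_le_iff of_nat_eq_iff of_nat_eq_0_iff of_nat_max[symmetric] of_nat_le_iff
      ball_triv simp_thms)

lemma represents_ultrametric:
  assumes "represents t M d" "canon t" "0 \<notin> set_tree t"
  shows "ultrametric_on M (\<lambda>x y. real (d x y))"
  using assms
proof (induction t arbitrary: M)
  case Leaf
  then show ?case by (auto simp: ultrametric_on_def)
next
  case (Node l v r)
  obtain A B where AB: "M = A \<union> B" "A \<inter> B = {}" "represents l A d" "represents r B d"
    "\<forall>a\<in>A. \<forall>b\<in>B. d a b = v \<and> d b a = v" using Node.prems by auto
  have v: "0 < v" "\<forall>x\<in>set_tree l \<union> set_tree r. x < v"
    using Node.prems by (auto intro: gr0I)
  have U: "ultrametric_on A (\<lambda>x y. real (d x y))" "ultrametric_on B (\<lambda>x y. real (d x y))"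
    using Node AB by auto
  have lt: "d x y < v" if "x \<in> A \<and> y \<in> A \<or> x \<in> B \<and> y \<in> B" for x y
    using that represents_value[OF AB(3), of x y] represents_value[OF AB(4), of x y] v by auto
  note U = U[unfolded ultrametric_on_of_nat_iff]
  have "d x y \<le> max (d x z) (d z y)" if M: "x \<in> M" "y \<in> M" "z \<in> M" for x y z
  proof -
    \<comment> \<open>Unless all three points share a part, \<open>z\<close> is separated from
      \<open>x\<close> or from \<open>y\<close>, and that distance is the maximal value
      \<open>v\<close>.\<close>
    consider "x \<in> A" "y \<in> A" "z \<in> A" | "x \<in> B" "y \<in> B" "z \<in> B" | "d x z = v \<or> d z y = v"
      using M AB(1,5) by auto
    then show ?thesis
    proof cases
      case 1
      then show ?thesis using U(1) by blast
    next
      case 2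
      then show ?thesis using U(2) by blast
    next
      case 3
      have "d x y \<le> v" using M AB(1,5) lt[of x y] by auto
      then show ?thesis using 3 by auto
    qed
  qed
  moreover have "d x y = d y x" if "x \<in> M" "y \<in> M" for x y
    using that AB(1,5) U by (metis UnE)
  moreover have "d x y = 0 \<longleftrightarrow> x = y" if "x \<in> M" "y \<in> M" for x y
    using that AB(1,2,5) U v(1) by (metis UnE disjoint_iff less_irrefl)
  ultimately show ?case unfolding ultrametric_on_of_nat_iff by metis
qed

text \<open>The points are split according to the numbers of leaves of the subtrees; the distances
  of the two parts are combined with the root label as the value across.\<close>

lemma ex_represented:
  assumes "finite M" "card M = size t + 1"
  shows "\<exists>d. represents t M d"
  using assms
proof (induction t arbitrary: M)
  case Leaf
  then obtain x where "M = {x}" by (auto simp: card_1_singleton_iff)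
  then show ?case by (auto intro!: exI[of _ "\<lambda>_ _. 0"])
next
  case (Node l v r)
  obtain A where A: "A \<subseteq> M" "card A = size l + 1"
    using Node.prems
    by (metis le_add1 obtain_subset_with_card_n size1_size tree.size(4) add.assoc add.commute)
  define B where "B = M - A"
  have fin: "finite A" "finite B" using A Node.prems finite_subset by (auto simp: B_def)
  have "card B = size r + 1"
    using A fin Node.prems by (simp add: B_def card_Diff_subset)
  then obtain d e where d: "represents l A d" and e: "represents r B e"
    using Node.IH fin A(2) by meson
  define f where "f = (\<lambda>x y. if x \<in> A \<and> y \<in> A then d x y else if x \<in> B \<and> y \<in> B then e x y else v)"
  have "represents l A f" using d by (rule represents_cong) (simp add: f_def)
  moreover have "represents r B f" using e by (rule represents_cong) (simp add: f_def B_def)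
  moreover have "M = A \<union> B" "A \<inter> B = {}" using A by (auto simp: B_def)
  moreover have "\<forall>a\<in>A. \<forall>b\<in>B. f a b = v \<and> f b a = v" by (auto simp: f_def B_def)
  ultimately show ?case unfolding represents.simps by blast
qed

section \<open>From ultrametrics to trees\<close>

lemma ultrametric_on_subset: "ultrametric_on M d \<Longrightarrow> A \<subseteq> M \<Longrightarrow> ultrametric_on A d"
  unfolding ultrametric_on_def by (meson subset_iff)

text \<open>Bound and tree are proved together: only the bound for both parts lets equality for
  \<open>M\<close> pass down to them.\<close>

lemma ultrametric_represented:
  fixes d :: "'a \<Rightarrow> 'a \<Rightarrow> nat"
  assumes "finite M" "M \<noteq> {}" "ultrametric_on M (\<lambda>x y. real (d x y))"
  defines "V \<equiv> \<lambda>M. (\<lambda>(x, y). d x y) ` (M \<times> M)"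
  shows "card (V M) \<le> card M \<and> (card (V M) = card M \<longrightarrow>
    (\<exists>t. canon t \<and> 0 \<notin> set_tree t \<and> represents t M d))"
  using assms(1-3)
proof (induction M rule: finite_psubset_induct)
  case (psubset M)
  note U = psubset.prems(2)[unfolded ultrametric_on_of_nat_iff]
  note sym = U[THEN conjunct1, rule_format]
    and zero = U[THEN conjunct2, THEN conjunct1, rule_format]
    and ultra = U[THEN conjunct2, THEN conjunct2, rule_format]
  obtain p where p: "p \<in> M" using psubset.prems by blast
  show ?case
  proof (cases "M = {p}")
    case True
    then show ?thesis using zero by (auto simp: V_def intro!: exI[of _ Leaf])
  next
    case False
    have finV: "finite (V N)" if "N \<subseteq> M" for N
      using finite_subset[OF that psubset.hyps] by (simp add: V_def)
    have V_mem: "d x y \<in> V N" if "x \<in> N" "y \<in> N" for x y N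
      using that by (auto simp: V_def intro: rev_image_eqI[of "(x, y)"])
    define D where "D = Max (V M)"
    have D: "d x y \<le> D" if "x \<in> M" "y \<in> M" for x y
      using V_mem[OF that] finV[of M] by (simp add: D_def)
    have "D \<in> V M" unfolding D_def using V_mem[OF p p] finV[of M] by (intro Max_in) auto
    then obtain x z where xz: "x \<in> M" "z \<in> M" "d x z = D" by (auto simp: V_def)
    obtain q where "q \<in> M" "q \<noteq> p" using False p by blast
    then have "0 < D" using D[OF p, of q] zero[OF p, of q] by (metis gr0I le_zero_eq)
    \<comment> \<open>\<open>A\<close> is the open ball of radius \<open>D\<close> around
      \<open>x\<close>, one end of a diameter; the other end \<open>z\<close> lies in the
      complement.\<close>
    define A where "A = {y \<in> M. d x y < D}"
    define B where "B = M - A"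
    have AB: "M = A \<union> B" "A \<inter> B = {}" by (auto simp: A_def B_def)
    have inA: "x \<in> A" using xz \<open>0 < D\<close> zero[of x x] by (simp add: A_def)
    have inB: "z \<in> B" using xz by (simp add: A_def B_def)
    have cross: "d a b = D \<and> d b a = D" if "a \<in> A" "b \<in> B" for a b
    proof -
      have m: "a \<in> M" "b \<in> M" "d x a < D" "\<not> d x b < D" using that by (auto simp: A_def B_def)
      \<comment> \<open>If \<open>d a b\<close> were below \<open>D\<close>, then
        \<open>d x b\<close> would be at most the larger of \<open>d x a\<close> and
        \<open>d a b\<close>, hence below \<open>D\<close>, against \<open>b\<close> lying outside
        the ball.\<close>
      then have "D \<le> d a b" using ultra[of x b a] xz(1) by (auto simp: le_max_iff_disj)
      then show ?thesis using D[OF m(1,2)] sym[OF m(1,2)] by simp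
    qed
    have sub: "A \<subset> M" "B \<subset> M" using AB inA inB by auto
    have IH: "card (V N) \<le> card N \<and> (card (V N) = card N \<longrightarrow>
      (\<exists>t. canon t \<and> 0 \<notin> set_tree t \<and> represents t N d))" if "N \<subset> M" "N \<noteq> {}" for N
      using that psubset.IH ultrametric_on_subset[OF psubset.prems(2)] by blast
    note IHA = IH[OF sub(1)] and IHB = IH[OF sub(2)]
    have fin: "finite (V A)" "finite (V B)" using sub finV by blast+
    have V: "V M = insert D (V A \<union> V B)"
      unfolding V_def AB(1) using inA inB cross by (intro image_Times_Un_const) auto
    have z0: "0 \<in> V A" "0 \<in> V B"
      using V_mem[OF inA inA] V_mem[OF inB inB] zero[of x x] zero[of z z] xz by simp_all
    then have "{0} \<subseteq> V A \<inter> V B" by simp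
    then have i: "1 \<le> card (V A \<inter> V B)" "card (V A \<inter> V B) = 1 \<longrightarrow> V A \<inter> V B = {0}"
      using fin card_mono[of "V A \<inter> V B" "{0}"] card_subset_eq[of "V A \<inter> V B" "{0}"] by auto
    \<comment> \<open>The common value 0 costs at least one, and the new value \<open>D\<close>
      gains at most one, so \<open>V M\<close> has at most as many elements as the parts have points
      together.\<close>
    have u: "card (V A) + card (V B) = card (V A \<union> V B) + card (V A \<inter> V B)"
      using fin by (rule card_Un_Int)
    have m: "card (V M) = card (V A \<union> V B) + (if D \<in> V A \<union> V B then 0 else 1)"
      using fin V by (simp add: insert_absorb)
    have cM: "card M = card A + card B"
      using AB psubset.hyps by (metis card_Un_disjoint finite_Un)
    have ne: "A \<noteq> {}" "B \<noteq> {}" using inA inB by auto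
    have "\<exists>t. canon t \<and> 0 \<notin> set_tree t \<and> represents t M d" if eq: "card (V M) = card M"
    proof -
      \<comment> \<open>Equality for \<open>M\<close> makes every estimate sharp: both parts attain
        the bound, only 0 is shared, and \<open>D\<close> is new.\<close>
      have "card (V A) = card A" "card (V B) = card B" and c1: "card (V A \<inter> V B) = 1"
        and DV: "D \<notin> V A \<union> V B"
        using eq IHA[OF ne(1)] IHB[OF ne(2)] i(1) u m cM by (auto split: if_splits)
      then obtain l r where l: "canon l" "0 \<notin> set_tree l" "represents l A d"
        and r: "canon r" "0 \<notin> set_tree r" "represents r B d"
        using IHA[OF ne(1)] IHB[OF ne(2)] by blast
      have Vl: "V A = insert 0 (set_tree l)" and Vr: "V B = insert 0 (set_tree r)"
        unfolding V_def using l r by (auto dest: represents_values)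
      have disj: "set_tree l \<inter> set_tree r = {}"
        using i(2) c1 l(2) unfolding Vl Vr by auto
      have lt: "\<forall>y\<in>set_tree l \<union> set_tree r. y < D"
      proof
        fix y assume y: "y \<in> set_tree l \<union> set_tree r"
        then have "y \<in> V M" "y \<noteq> D" using V Vl Vr DV by auto
        then show "y < D" using finV[of M] Max_ge[of "V M" y] by (simp add: D_def le_neq_implies_less)
      qed
      show ?thesis
        using dominated_total[OF finite_set_tree finite_set_tree disj]
      proof
        assume "\<forall>y\<in>set_tree r. \<exists>x\<in>set_tree l. y < x"
        then have "canon (Node l D r)" "0 \<notin> set_tree (Node l D r)"
          using l r disj lt \<open>0 < D\<close> by auto
        moreover have "represents (Node l D r) M d"
          unfolding represents.simps using AB l r cross
          by (intro exI[of _ A] exI[of _ B]) simp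
        ultimately show ?thesis by blast
      next
        assume "\<forall>y\<in>set_tree l. \<exists>x\<in>set_tree r. y < x"
        then have "canon (Node r D l)" "0 \<notin> set_tree (Node r D l)"
          using l r disj lt \<open>0 < D\<close> by auto
        moreover have "represents (Node r D l) M d"
          unfolding represents.simps using AB l r cross
          by (intro exI[of _ B] exI[of _ A]) (simp add: Un_commute Int_commute)
        ultimately show ?thesis by blast
      qed
    qed
    moreover have "card (V M) \<le> card M"
      using IHA[OF ne(1)] IHB[OF ne(2)] i(1) u m cM by (auto split: if_splits)
    ultimately show ?thesis by blast
  qed
qed

section \<open>Weak similarity in terms of ranks and trees\<close>

text \<open>A normal form that forgets the sizes of the distances and keeps their order.\<close>

definition rank_dist :: "'a metric \<Rightarrow> 'a \<Rightarrow> 'a \<Rightarrow> nat" where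
  "rank_dist X x y = rank_in (Sp X) (mdist X x y)"

lemma frakU_cardD:
  assumes "X \<in> \<UU>\<^bsub>n\<^esub>"
  shows "finite (mspace X)" "ultrametric_on (mspace X) (mdist X)" "card (mspace X) = n"
    "finite (Sp X)" "card (Sp X) = n"
proof -
  show *: "finite (mspace X)" "ultrametric_on (mspace X) (mdist X)" "card (mspace X) = n"
    "card (Sp X) = n"
    using assms by (auto simp: frakU_card_def frakU_def)
  have "Sp X = (\<lambda>(x, y). mdist X x y) ` (mspace X \<times> mspace X)" by (auto simp: Sp_def)
  then show "finite (Sp X)" using *(1) by simp
qed

lemma mdist_in_Sp: "x \<in> mspace X \<Longrightarrow> y \<in> mspace X \<Longrightarrow> mdist X x y \<in> Sp X"
  by (auto simp: Sp_def)

text \<open>Increasing bijections preserve ranks. Conversely, both spectra have \<open>n\<close>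
  elements, so matching elements of equal rank yields the required increasing bijection.\<close>

lemma weakly_similar_iff_rank_dist:
  assumes "X \<in> \<UU>\<^bsub>n\<^esub>" "Y \<in> \<UU>\<^bsub>n\<^esub>"
  shows "X \<simeq> Y \<longleftrightarrow> (\<exists>\<Phi>. bij_betw \<Phi> (mspace X) (mspace Y) \<and>
    (\<forall>x\<in>mspace X. \<forall>y\<in>mspace X. rank_dist Y (\<Phi> x) (\<Phi> y) = rank_dist X x y))"
    (is "_ \<longleftrightarrow> ?R")
proof
  assume "X \<simeq> Y"
  then obtain \<Phi> f where \<Phi>: "bij_betw \<Phi> (mspace X) (mspace Y)"
    and f: "bij_betw f (Sp Y) (Sp X)" "strict_mono_on (Sp Y) f"
    and d: "\<forall>x\<in>mspace X. \<forall>y\<in>mspace X. mdist X x y = f (mdist Y (\<Phi> x) (\<Phi> y))"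
    unfolding weakly_similar_def weak_similarity_def by blast
  have "rank_dist Y (\<Phi> x) (\<Phi> y) = rank_dist X x y" if "x \<in> mspace X" "y \<in> mspace X" for x y
    using that d rank_in_image[OF f(2)] f(1) bij_betwE[OF \<Phi>]
    by (auto simp: rank_dist_def bij_betw_def mdist_in_Sp)
  then show ?R using \<Phi> by blast
next
  assume ?R
  then obtain \<Phi> where \<Phi>: "bij_betw \<Phi> (mspace X) (mspace Y)"
    and d: "\<forall>x\<in>mspace X. \<forall>y\<in>mspace X. rank_dist Y (\<Phi> x) (\<Phi> y) = rank_dist X x y" by blast
  note X = frakU_cardD[OF assms(1)] and Y = frakU_cardD[OF assms(2)]
  have bX: "bij_betw (rank_in (Sp X)) (Sp X) {..<n}" using rank_in_bij[OF X(4)] X(5) by simp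
  have bY: "bij_betw (rank_in (Sp Y)) (Sp Y) {..<n}" using rank_in_bij[OF Y(4)] Y(5) by simp
  define f where "f = inv_into (Sp X) (rank_in (Sp X)) \<circ> rank_in (Sp Y)"
  have f: "bij_betw f (Sp Y) (Sp X)"
    unfolding f_def by (rule bij_betw_trans[OF bY bij_betw_inv_into[OF bX]])
  have rf: "rank_in (Sp X) (f s) = rank_in (Sp Y) s" if "s \<in> Sp Y" for s
    using that bij_betwE[OF bY] bij_betw_inv_into_right[OF bX] by (simp add: f_def)
  have "strict_mono_on (Sp Y) f"
  proof (rule strict_mono_onI)
    fix r s assume "r \<in> Sp Y" "s \<in> Sp Y" "r < s"
    then show "f r < f s"
      using rank_in_less_iff[OF X(4), of "f r" "f s"] rank_in_less_iff[OF Y(4), of r s]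
        bij_betwE[OF f] rf by simp
  qed
  moreover have "mdist X x y = f (mdist Y (\<Phi> x) (\<Phi> y))" if "x \<in> mspace X" "y \<in> mspace X" for x y
  proof -
    have "f (mdist Y (\<Phi> x) (\<Phi> y)) = inv_into (Sp X) (rank_in (Sp X)) (rank_dist Y (\<Phi> x) (\<Phi> y))"
      by (simp add: f_def rank_dist_def)
    also have "\<dots> = mdist X x y"
      using that d bij_betw_inv_into_left[OF bX] by (simp add: rank_dist_def mdist_in_Sp)
    finally show ?thesis by simp
  qed
  ultimately show "X \<simeq> Y" using \<Phi> f unfolding weakly_similar_def weak_similarity_def by blast
qed

text \<open>The strong triangle inequality involves only the order of distances, which ranks
  preserve; distance 0 is the least element of the spectrum and so has rank 0.\<close>

lemma rank_dist_ultrametric: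
  assumes "X \<in> \<UU>\<^bsub>n\<^esub>"
  shows "ultrametric_on (mspace X) (\<lambda>x y. real (rank_dist X x y))"
proof -
  note X = frakU_cardD[OF assms]
  have le: "rank_in (Sp X) r \<le> rank_in (Sp X) s \<longleftrightarrow> r \<le> s" if "r \<in> Sp X" "s \<in> Sp X" for r s
    using rank_in_less_iff[OF X(4) that(2,1)] by (simp add: not_less [symmetric])
  have "{r \<in> Sp X. r < 0} = {}" by (auto simp: Sp_def not_less)
  then have "rank_in (Sp X) 0 = 0" by (simp only: rank_in_def card.empty)
  moreover have mdist_0: "mdist X x y = 0 \<longleftrightarrow> x = y" if "x \<in> mspace X" "y \<in> mspace X" for x y
    using X(2) that by (simp add: ultrametric_on_def)
  moreover have "mdist X x y \<le> 0 \<longleftrightarrow> mdist X x y = 0" for x y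
    using mdist_nonneg[of X x y] by linarith
  ultimately have zero: "rank_dist X x y = 0 \<longleftrightarrow> x = y" if "x \<in> mspace X" "y \<in> mspace X" for x y
    using le[OF mdist_in_Sp[OF that] mdist_in_Sp[OF that(1) that(1)]]
      mdist_0[OF that] mdist_0[OF that(1) that(1)] by (auto simp: rank_dist_def)
  have ultra: "rank_dist X x y \<le> max (rank_dist X x z) (rank_dist X z y)"
    if "x \<in> mspace X" "y \<in> mspace X" "z \<in> mspace X" for x y z
  proof -
    have "mdist X x y \<le> max (mdist X x z) (mdist X z y)"
      using X(2) that unfolding ultrametric_on_def by blast
    then show ?thesis using that by (simp add: rank_dist_def le mdist_in_Sp le_max_iff_disj)
  qed
  have "rank_dist X x y = rank_dist X y x" for x y
    by (simp add: rank_dist_def mdist_commute)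
  then show ?thesis
    unfolding ultrametric_on_of_nat_iff using zero ultra by metis
qed

lemma rank_dist_values:
  assumes "X \<in> \<UU>\<^bsub>n\<^esub>"
  shows "(\<lambda>(x, y). rank_dist X x y) ` (mspace X \<times> mspace X) = {..<n}"
proof -
  note X = frakU_cardD[OF assms]
  have "(\<lambda>(x, y). rank_dist X x y) ` (mspace X \<times> mspace X) = rank_in (Sp X) ` Sp X"
    by (force simp: Sp_def rank_dist_def)
  also have "\<dots> = {..<n}" using rank_in_bij[OF X(4)] X(5) by (simp add: bij_betw_def)
  finally show ?thesis .
qed

text \<open>For a nonempty space in \<open>frakU\<close> the chosen tree exists by
  \<open>ultrametric_represented\<close> and is unique by \<open>represents_unique\<close>.\<close>

definition tree_of :: "'a metric \<Rightarrow> nat tree" where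
  "tree_of X = (SOME t. canon t \<and> 0 \<notin> set_tree t \<and> represents t (mspace X) (rank_dist X))"

text \<open>Ranks take exactly \<open>n\<close> values on \<open>n\<close> points, the equality case
  of \<open>ultrametric_represented\<close>. The labels are the nonzero ranks.\<close>

lemma tree_of:
  assumes "X \<in> \<UU>\<^bsub>n\<^esub>" "0 < n"
  shows "canon (tree_of X)" "0 \<notin> set_tree (tree_of X)"
    "represents (tree_of X) (mspace X) (rank_dist X)"
    "set_tree (tree_of X) = {1..<n}"
proof -
  note X = frakU_cardD[OF assms(1)]
  have "mspace X \<noteq> {}" using X(3) assms(2) by auto
  then have "\<exists>t. canon t \<and> 0 \<notin> set_tree t \<and> represents t (mspace X) (rank_dist X)"
    using ultrametric_represented[OF X(1) _ rank_dist_ultrametric[OF assms(1)]]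
      rank_dist_values[OF assms(1)] X(3) by simp
  then have "canon (tree_of X) \<and> 0 \<notin> set_tree (tree_of X) \<and>
      represents (tree_of X) (mspace X) (rank_dist X)"
    unfolding tree_of_def by (rule someI_ex)
  then show *: "canon (tree_of X)" "0 \<notin> set_tree (tree_of X)"
    "represents (tree_of X) (mspace X) (rank_dist X)" by blast+
  have "insert 0 (set_tree (tree_of X)) = {..<n}"
    using represents_values[OF *(3)] rank_dist_values[OF assms(1)] by simp
  also have "\<dots> = insert 0 {1..<n}" using assms(2) by auto
  finally show "set_tree (tree_of X) = {1..<n}" using *(2) by (simp add: insert_ident)
qed

text \<open>A weak similarity is an isometry of rank distances, which transports the tree of
  \<open>X\<close> to \<open>Y\<close>, where uniqueness applies; equal trees give an isometry
  back.\<close>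

lemma weakly_similar_iff_tree_of:
  assumes "X \<in> \<UU>\<^bsub>n\<^esub>" "Y \<in> \<UU>\<^bsub>n\<^esub>" "0 < n"
  shows "X \<simeq> Y \<longleftrightarrow> tree_of X = tree_of Y"
proof
  note X = tree_of[OF assms(1,3)] and Y = tree_of[OF assms(2,3)]
  {
    assume "X \<simeq> Y"
    then obtain \<Phi> where \<Phi>: "bij_betw \<Phi> (mspace X) (mspace Y)"
      "\<forall>x\<in>mspace X. \<forall>y\<in>mspace X. rank_dist Y (\<Phi> x) (\<Phi> y) = rank_dist X x y"
      using weakly_similar_iff_rank_dist[OF assms(1,2)] by blast
    have "represents (tree_of X) (\<Phi> ` mspace X) (rank_dist Y)"
      using X(3) by (rule represents_image) (use \<Phi> in \<open>auto simp: bij_betw_def\<close>)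
    then have "represents (tree_of X) (mspace Y) (rank_dist Y)"
      using \<Phi>(1) by (simp add: bij_betw_def)
    then show "tree_of X = tree_of Y" using represents_unique X Y by blast
  }
  assume "tree_of X = tree_of Y"
  then show "X \<simeq> Y"
    using represents_isometry[of "tree_of X"] X(3) Y(3)
    by (simp add: weakly_similar_iff_rank_dist[OF assms(1,2)])
qed

lemma tree_of_surj:
  assumes t: "t \<in> canon_trees {1..<n}" and "0 < n"
  shows "\<exists>X :: 'a::infinite metric. X \<in> \<UU>\<^bsub>n\<^esub> \<and> tree_of X = t"
proof -
  have t': "canon t" "set_tree t = {1..<n}" "0 \<notin> set_tree t"
    using t by (auto simp: canon_trees_def)
  then have n: "size t + 1 = n" using canon_card_set_tree[OF t'(1)] assms(2) by simp
  obtain M :: "'a set" where M: "finite M" "card M = n"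
    using infinite_arbitrarily_large[OF infinite_UNIV] by blast
  then obtain d where d: "represents t M d" using ex_represented[of M t] n by auto
  \<comment> \<open>The value 0 off \<open>M\<close> is needed because \<open>Metric_space\<close>
    demands nonnegativity and symmetry for all arguments.\<close>
  define e where "e = (\<lambda>x y. if x \<in> M \<and> y \<in> M then real (d x y) else 0)"
  have "ultrametric_on M e \<longleftrightarrow> ultrametric_on M (\<lambda>x y. real (d x y))"
    unfolding ultrametric_on_def e_def by (simp only: simp_thms if_True cong: ball_cong)
  then have U: "ultrametric_on M e"
    using represents_ultrametric[OF d t'(1,3)] by simp
  have "Metric_space M e"
  proof
    show "0 \<le> e x y" "e x y = e y x" for x y
      using U by (auto simp: ultrametric_on_def e_def)
    show "e x y = 0 \<longleftrightarrow> x = y" if "x \<in> M" "y \<in> M" for x y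
      using U that by (simp add: ultrametric_on_def)
    show "e x z \<le> e x y + e y z" if "x \<in> M" "y \<in> M" "z \<in> M" for x y z
    proof -
      have "e x z \<le> max (e x y) (e y z)" "0 \<le> e x y" "0 \<le> e y z"
        using U that by (auto simp: ultrametric_on_def)
      then show ?thesis by linarith
    qed
  qed
  then interpret Metric_space M e .
  define X where "X = metric (M, e)"
  have X [simp]: "mspace X = M" "mdist X = e" by (simp_all add: X_def)
  have "Sp X = real ` ((\<lambda>(x, y). d x y) ` (M \<times> M))"
    by (force simp: Sp_def e_def)
  also have "(\<lambda>(x, y). d x y) ` (M \<times> M) = {..<n}"
    using represents_values[OF d] t'(2) assms(2) by auto
  finally have Sp: "Sp X = real ` {..<n}" .
  then have XU: "X \<in> \<UU>\<^bsub>n\<^esub>" using M U by (simp add: frakU_card_def frakU_def card_image)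
  \<comment> \<open>The spectrum consists of the numbers below \<open>n\<close>, so each distance is
    its own rank.\<close>
  have "rank_dist X x y = d x y" if "x \<in> M" "y \<in> M" for x y
  proof -
    have "d x y \<in> {..<n}"
      using represents_value[OF d that] t'(2) assms(2) by auto
    then have "rank_in (real ` {..<n}) (real (d x y)) = rank_in {..<n} (d x y)"
      by (intro rank_in_image) (simp_all add: strict_mono_on_def)
    also have "{r \<in> {..<n}. r < d x y} = {..<d x y}" using \<open>d x y \<in> {..<n}\<close> by auto
    then have "rank_in {..<n} (d x y) = d x y" by (simp add: rank_in_def)
    finally show ?thesis using that by (simp add: rank_dist_def Sp e_def)
  qed
  then have "represents t (mspace X) (rank_dist X)"
    using represents_cong[OF d] by simp
  then have "tree_of X = t"
    using represents_unique t' tree_of[OF XU assms(2)] by blast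
  then show ?thesis using XU by blast
qed

section \<open>Counting weak similarity classes\<close>

lemma card_quotient_kernel:
  "card (A // {(x, y). x \<in> A \<and> y \<in> A \<and> f x = f y}) = card (f ` A)"
proof -
  have "bij_betw (\<lambda>y. {x \<in> A. f x = y}) (f ` A) (A // {(x, y). x \<in> A \<and> y \<in> A \<and> f x = f y})"
  proof (rule bij_betw_imageI)
    show "inj_on (\<lambda>y. {x \<in> A. f x = y}) (f ` A)" by (auto simp: inj_on_def)
    have "{(x, y). x \<in> A \<and> y \<in> A \<and> f x = f y} `` {a} = {x \<in> A. f x = f a}" if "a \<in> A" for a
      using that by auto
    then show "(\<lambda>y. {x \<in> A. f x = y}) ` f ` A = A // {(x, y). x \<in> A \<and> y \<in> A \<and> f x = f y}"
      by (auto simp: quotient_def)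
  qed
  then show ?thesis by (rule bij_betw_same_card[symmetric])
qed

text \<open>\<open>tree_of\<close> is a complete invariant, and every canonical tree on the
  \<open>n - 1\<close> nonzero ranks occurs.\<close>

lemma kappa_frakU_card:
  assumes "0 < n"
  shows "\<kappa> (\<UU>\<^bsub>n\<^esub> :: 'a::infinite metric set) = canon_count (n - 1)"
proof -
  have "weak_sim_rel (\<UU>\<^bsub>n\<^esub> :: 'a metric set) =
    {(X, Y). X \<in> \<UU>\<^bsub>n\<^esub> \<and> Y \<in> \<UU>\<^bsub>n\<^esub> \<and> tree_of X = tree_of Y}"
    using weakly_similar_iff_tree_of assms by (auto simp: weak_sim_rel_def)
  then have "\<kappa> (\<UU>\<^bsub>n\<^esub> :: 'a metric set) = card (tree_of ` (\<UU>\<^bsub>n\<^esub> :: 'a metric set))"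
    by (simp add: kappa_def card_quotient_kernel)
  also have "tree_of ` (\<UU>\<^bsub>n\<^esub> :: 'a metric set) = canon_trees {1..<n}"
  proof
    show "tree_of ` (\<UU>\<^bsub>n\<^esub> :: 'a metric set) \<subseteq> canon_trees {1..<n}"
      using tree_of(1,4)[OF _ assms] by (force simp: canon_trees_def)
    show "canon_trees {1..<n} \<subseteq> tree_of ` (\<UU>\<^bsub>n\<^esub> :: 'a metric set)"
      using tree_of_surj[OF _ assms] by blast
  qed
  also have "card \<dots> = canon_count (n - 1)" by (simp add: card_canon_trees)
  finally show ?thesis .
qed

theorem proposition3p2:
  shows "\<kappa> (\<UU>\<^bsub>1\<^esub> :: 'a::infinite metric set) = 1
    \<and> \<kappa> (\<UU>\<^bsub>2\<^esub> :: 'a metric set) = 1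
    \<and> (\<forall>n::nat. n \<ge> 3 \<longrightarrow>
        \<kappa> (\<UU>\<^bsub>n\<^esub> :: 'a metric set) =
          (\<Sum>k = 2..n - 1. ((n - 3) choose (k - 2))
             * \<kappa> (\<UU>\<^bsub>k\<^esub> :: 'a metric set) * \<kappa> (\<UU>\<^bsub>n - k\<^esub> :: 'a metric set)))"
proof (intro conjI allI impI)
  show "\<kappa> (\<UU>\<^bsub>1\<^esub> :: 'a metric set) = 1" by (simp add: kappa_frakU_card canon_count_0)
  show "\<kappa> (\<UU>\<^bsub>2\<^esub> :: 'a metric set) = 1" using canon_count_1 by (simp add: kappa_frakU_card)
  fix n :: nat
  assume "3 \<le> n"
  then obtain m where n: "n = m + 3" by (metis le_Suc_ex add.commute)
  have "\<kappa> (\<UU>\<^bsub>n\<^esub> :: 'a metric set) = canon_count (m + 2)" by (simp add: kappa_frakU_card n)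
  also have "\<dots> = (\<Sum>j\<le>m. (m choose j) * (canon_count (j + 1) * canon_count (m - j)))"
    by (rule canon_count_rec)
  also have "\<dots> = (\<Sum>k = 2..n - 1. ((n - 3) choose (k - 2))
      * \<kappa> (\<UU>\<^bsub>k\<^esub> :: 'a metric set) * \<kappa> (\<UU>\<^bsub>n - k\<^esub> :: 'a metric set))"
    \<comment> \<open>With \<open>n = m + 3\<close> and \<open>k = j + 2\<close>, the spaces of
      sizes \<open>k\<close> and \<open>n - k\<close> have trees with \<open>j + 1\<close> and
      \<open>m - j\<close> labels. Since \<open>k\<close> is at most \<open>n - 1\<close>, the size
      \<open>n - k\<close> is positive, as \<open>kappa_frakU_card\<close> requires.\<close>
    by (rule sum.reindex_bij_witness[of _ "\<lambda>k. k - 2" "\<lambda>j. j + 2"])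
      (auto simp: n kappa_frakU_card)
  finally show "\<kappa> (\<UU>\<^bsub>n\<^esub> :: 'a metric set) =
      (\<Sum>k = 2..n - 1. ((n - 3) choose (k - 2))
        * \<kappa> (\<UU>\<^bsub>k\<^esub> :: 'a metric set) * \<kappa> (\<UU>\<^bsub>n - k\<^esub> :: 'a metric set))" .
qed

end
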